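(* For every integer $k\geq 3$, \[ \sum_{\substack{\lambda\vdash k\\ l(\lambda)=5,\ \lambda_5=1}} f_\lambda=\frac{\lfloor\frac{k+1}{2}\rfloor\left(\lceil\frac{k+1}{2}\rceil+1\right)}{k+1}\,C_{\lfloor\frac{k+1}{2}\rfloor}C_{\lceil\frac{k+1}{2}\rceil}-C_{\lfloor\frac{k}{2}\rfloor+1}C_{\lceil\frac{k}{2}\rceil+1}+M_k . \]
   Context: $f_\lambda$ is the number of standard Young tableaux of shape $\lambda$ and $l(\lambda)$ is the number of parts of $\lambda$; so the left side counts standard Young tableaux with exactly $5$ rows whose fifth row has length $1$. $C_i=\frac{1}{i+1}\binom{2i}{i}$ is the $i$-th Catalan number and $M_k=\sum_{i\ge 0}\frac{1}{i+1}\binom{k}{2i}\binom{2i}{i}$ is the $k$-th Motzkin number. *)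

theory Defs
  imports Complex_Main
begin

definition is_partition :: "nat \<Rightarrow> nat list \<Rightarrow> bool" where
  "is_partition k lam \<longleftrightarrow> sorted_wrt (\<ge>) lam \<and> (\<forall>x\<in>set lam. 0 < x) \<and> sum_list lam = k"

definition cells :: "nat list \<Rightarrow> (nat \<times> nat) set" where
  "cells lam = {(i, j). i < length lam \<and> j < lam ! i}"

definition SYT :: "nat list \<Rightarrow> (nat \<times> nat \<Rightarrow> nat) set" where
  "SYT lam = {T. bij_betw T (cells lam) {1..sum_list lam}
      \<and> (\<forall>c. c \<notin> cells lam \<longrightarrow> T c = 0)
      \<and> (\<forall>i j. (i, j + 1) \<in> cells lam \<longrightarrow> T (i, j) < T (i, j + 1))
      \<and> (\<forall>i j. (i + 1, j) \<in> cells lam \<longrightarrow> T (i, j) < T (i + 1, j))}"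

definition num_syt :: "nat list \<Rightarrow> nat" where
  "num_syt lam = card (SYT lam)"

definition catalan :: "nat \<Rightarrow> real" where
  "catalan i = 1 / (real i + 1) * real ((2 * i) choose i)"

definition motzkin :: "nat \<Rightarrow> real" where
  "motzkin k = (\<Sum>i\<le>k. 1 / (real i + 1) * real (k choose (2 * i)) * real ((2 * i) choose i))"

end

theory Submission
  imports Defs
begin

text \<open>
  Let \<open>y\<^sub>h(k)\<close> be the number of standard tableaux with \<open>k\<close> cells and at most \<open>h\<close> rows. Expanding
  \<open>k f\<^sub>\<mu> = (\<Sum>\<lambda> covers \<mu>. f\<^sub>\<lambda>)\<close> over all \<open>\<mu>\<close> of size \<open>k - 1\<close> with at most four rows, the shapes \<open>\<lambda>\<close> with
  five rows are exactly the ones to be counted, while a shape \<open>\<lambda>\<close> with at most four rows occurs once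
  for each of its removable boxes. Counting addable boxes instead, those shapes contribute
  \<open>y\<^sub>4(k + 1) - y\<^sub>3(k)\<close>, so the number sought is \<open>k y\<^sub>4(k - 1) - y\<^sub>4(k + 1) + y\<^sub>3(k)\<close>.

  The values \<open>y\<^sub>3\<close> (Motzkin numbers) and \<open>y\<^sub>4\<close> (products of two Catalan numbers) are obtained from the
  number of ways to extend a shape \<open>p\<close> by \<open>n\<close> boxes. This number is determined by its recursion in
  \<open>n\<close> and by its vanishing on the walls of the Weyl chamber, and a Pfaffian in the differences of the
  shifted parts \<open>p i - i\<close> satisfies both.
\<close>

section \<open>Fillings and corners\<close>

text \<open>The conditions of \<open>SYT\<close>, stated for any set of cells, so that deleting a
  cell stays within the same notion. The default value 0 outside \<open>S\<close> makes each filling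
  a unique function.\<close>

definition fillings :: "(nat \<times> nat) set \<Rightarrow> (nat \<times> nat \<Rightarrow> nat) set" where
  "fillings S = {T. bij_betw T S {1..card S}
      \<and> (\<forall>c. c \<notin> S \<longrightarrow> T c = 0)
      \<and> (\<forall>i j. (i, j + 1) \<in> S \<longrightarrow> T (i, j) < T (i, j + 1))
      \<and> (\<forall>i j. (i + 1, j) \<in> S \<longrightarrow> T (i, j) < T (i + 1, j))}"

definition corners :: "(nat \<times> nat) set \<Rightarrow> (nat \<times> nat) set" where
  "corners S = {(i, j) \<in> S. (i + 1, j) \<notin> S \<and> (i, j + 1) \<notin> S}"

lemma finite_fillings:
  assumes "finite S"
  shows "finite (fillings S)"
proof (rule finite_subset)
  show "fillings S \<subseteq> {T. \<forall>c. (c \<in> S \<longrightarrow> T c \<in> {1..card S}) \<and> (c \<notin> S \<longrightarrow> T c = 0)}"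
    by (auto simp: fillings_def dest: bij_betw_apply)
  show "finite {T. \<forall>c. (c \<in> S \<longrightarrow> T c \<in> {1..card S}) \<and> (c \<notin> S \<longrightarrow> T c = (0::nat))}"
    by (rule finite_set_of_finite_funs) (use assms in auto)
qed

lemma fillings_le: "T \<in> fillings S \<Longrightarrow> T c \<le> card S"
  using bij_betw_apply[of T S "{1..card S}" c] by (cases "c \<in> S"; cases c) (auto simp: fillings_def)

lemma fillings_pos: "T \<in> fillings S \<Longrightarrow> c \<in> S \<Longrightarrow> 0 < T c"
  by (force simp: fillings_def dest: bij_betw_apply)

lemma fillings_remove_max:
  assumes "finite S" "c \<in> S" "T \<in> fillings S" "T c = card S"
  shows "T(c := 0) \<in> fillings (S - {c})"
proof -
  have bij: "bij_betw T S {1..card S}"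
    using assms(3) by (simp add: fillings_def)
  have card: "card (S - {c}) = card S - 1" "card S > 0"
    using assms card_gt_0_iff by auto
  have "bij_betw T (S - {c}) ({1..card S} - {T c})"
    using bij_betw_DiffI[OF bij, of "{c}" "{T c}"] assms(2) bij_betw_apply[OF bij] by simp
  also have "{1..card S} - {T c} = {1..card (S - {c})}"
    using card assms(4) by auto
  finally have "bij_betw (T(c := 0)) (S - {c}) {1..card (S - {c})}"
    by (subst bij_betw_cong[where g = T]) auto
  then show ?thesis
    using assms(3) fillings_pos[OF assms(3)] by (auto simp: fillings_def)
qed

lemma fillings_insert_max:
  assumes "finite S" "c \<in> corners S" "T \<in> fillings (S - {c})"
  shows "T(c := card S) \<in> fillings S"
proof -
  have cS: "c \<in> S"
    using assms(2) by (auto simp: corners_def)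
  have card: "card (S - {c}) = card S - 1" "card S > 0"
    using assms(1) cS card_gt_0_iff by auto
  have "bij_betw T (S - {c}) {1..card S - 1}"
    using assms(3) card by (simp add: fillings_def)
  then have "bij_betw (T(c := card S)) (S - {c}) {1..card S - 1}"
    by (subst bij_betw_cong[where g = T]) auto
  then have "bij_betw (T(c := card S)) ((S - {c}) \<union> {c}) ({1..card S - 1} \<union> {card S})"
    using card(2) by (intro bij_betw_combine) auto
  moreover have "(S - {c}) \<union> {c} = S" "{1..card S - 1} \<union> {card S} = {1..card S}"
    using cS card(2) by auto
  ultimately have bij: "bij_betw (T(c := card S)) S {1..card S}"
    by simp
  have less: "T d < card S" for d
    using fillings_le[OF assms(3), of d] card by linarith
  show ?thesis
    using assms(2,3) bij less cS by (auto simp: fillings_def corners_def)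
qed

text \<open>A cell of \<open>S\<close> directly below or to the right would need an entry exceeding
  \<open>card S\<close>.\<close>

lemma max_in_corners:
  assumes "T \<in> fillings S" "c \<in> S" "T c = card S"
  shows "c \<in> corners S"
proof (rule ccontr)
  obtain i j where c: "c = (i, j)" by force
  assume "c \<notin> corners S"
  then have "(i + 1, j) \<in> S \<or> (i, j + 1) \<in> S"
    using assms(2) c by (auto simp: corners_def)
  then have "T c < T (i + 1, j) \<or> T c < T (i, j + 1)"
    using assms(1) c unfolding fillings_def by blast
  then show False
    using fillings_le[OF assms(1)] assms(3) by (metis leD)
qed

text \<open>The fillings are classified by the position of the largest entry \<open>card S\<close>.
  That position is a corner, and erasing or restoring the entry there is a bijection with the
  fillings of \<open>S - {c}\<close>.\<close>

lemma card_fillings: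
  assumes "finite S" "S \<noteq> {}"
  shows "card (fillings S) = (\<Sum>c\<in>corners S. card (fillings (S - {c})))"
proof -
  define F where "F c = {T \<in> fillings S. T c = card S}" for c
  have inj: "inj_on T S" if "T \<in> fillings S" for T
    using that by (auto simp: fillings_def bij_betw_def)
  have sub: "corners S \<subseteq> S"
    by (auto simp: corners_def)
  have "\<exists>c \<in> corners S. T c = card S" if T: "T \<in> fillings S" for T
  proof -
    have "card S \<in> T ` S"
      using T assms card_gt_0_iff[of S] by (auto simp: fillings_def bij_betw_def)
    then show ?thesis
      using max_in_corners[OF T] by fastforce
  qed
  then have "fillings S = (\<Union>c\<in>corners S. F c)"
    by (auto simp: F_def)
  also have "card \<dots> = (\<Sum>c\<in>corners S. card (F c))"
  proof (rule card_UN_disjoint)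
    show "finite (corners S)"
      using sub assms(1) finite_subset by blast
    show "\<forall>c\<in>corners S. finite (F c)"
      using finite_fillings[OF assms(1)] by (simp add: F_def)
    show "\<forall>c\<in>corners S. \<forall>d\<in>corners S. c \<noteq> d \<longrightarrow> F c \<inter> F d = {}"
    proof (intro ballI impI)
      fix c d assume cd: "c \<in> corners S" "d \<in> corners S" "c \<noteq> d"
      have False if "T \<in> F c" "T \<in> F d" for T
        using inj_onD[OF inj, of T c d] that cd sub by (auto simp: F_def)
      then show "F c \<inter> F d = {}" by blast
    qed
  qed
  also have "\<dots> = (\<Sum>c\<in>corners S. card (fillings (S - {c})))"
  proof (rule sum.cong[OF refl])
    fix c assume c: "c \<in> corners S"
    then have cS: "c \<in> S" using sub by auto
    have "bij_betw (\<lambda>T. T(c := 0)) (F c) (fillings (S - {c}))"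
    proof (rule bij_betw_byWitness[where f' = "\<lambda>T. T(c := card S)"])
      show "\<forall>T\<in>F c. (T(c := 0))(c := card S) = T"
        by (auto simp: F_def)
      show "\<forall>T\<in>fillings (S - {c}). (T(c := card S))(c := 0) = T"
        by (cases c) (auto simp: fillings_def)
      show "(\<lambda>T. T(c := 0)) ` F c \<subseteq> fillings (S - {c})"
        using fillings_remove_max[OF assms(1) cS] by (auto simp: F_def)
      show "(\<lambda>T. T(c := card S)) ` fillings (S - {c}) \<subseteq> F c"
        using fillings_insert_max[OF assms(1) c] by (auto simp: F_def)
    qed
    then show "card (F c) = card (fillings (S - {c}))"
      by (rule bij_betw_same_card)
  qed
  finally show ?thesis .
qed

section \<open>Young's lattice\<close>

text \<open>Partitions of \<open>n\<close> into at most \<open>h\<close> parts, padded with zeros to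
  functions on all row indices; a box is then added or deleted by a pointwise update.\<close>

definition shapes :: "nat \<Rightarrow> nat \<Rightarrow> (nat \<Rightarrow> nat) set" where
  "shapes h n = {p. (\<forall>i. p (Suc i) \<le> p i) \<and> (\<forall>i\<ge>h. p i = 0) \<and> (\<Sum>i<h. p i) = n}"

definition diagram :: "(nat \<Rightarrow> nat) \<Rightarrow> (nat \<times> nat) set" where
  "diagram p = {(i, j). j < p i}"

definition num_fillings :: "(nat \<Rightarrow> nat) \<Rightarrow> nat" where
  "num_fillings p = card (fillings (diagram p))"

definition add_box :: "nat \<Rightarrow> (nat \<Rightarrow> nat) \<Rightarrow> nat \<Rightarrow> nat" where
  "add_box i p = p(i := p i + 1)"

definition del_box :: "nat \<Rightarrow> (nat \<Rightarrow> nat) \<Rightarrow> nat \<Rightarrow> nat" where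
  "del_box i p = p(i := p i - 1)"

text \<open>Row 0 is named separately because \<open>0 - 1 = 0\<close> on naturals. The set is not
  bounded by the row limit: row \<open>h\<close> can be addable to a shape in
  \<open>shapes h n\<close>, and sums confined to \<open>h\<close> rows intersect with
  \<open>{..<h}\<close>.\<close>

definition addable :: "(nat \<Rightarrow> nat) \<Rightarrow> nat set" where
  "addable p = {i. i = 0 \<or> p i < p (i - 1)}"

definition removable :: "(nat \<Rightarrow> nat) \<Rightarrow> nat set" where
  "removable p = {i. p (Suc i) < p i}"

lemma finite_shapes: "finite (shapes h n)"
proof (rule finite_subset)
  show "shapes h n \<subseteq> {p. \<forall>i. (i \<in> {..<h} \<longrightarrow> p i \<in> {..n}) \<and> (i \<notin> {..<h} \<longrightarrow> p i = 0)}"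
    by (auto simp: shapes_def intro: member_le_sum)
  show "finite {p. \<forall>i. (i \<in> {..<h} \<longrightarrow> p i \<in> {..n}) \<and> (i \<notin> {..<h} \<longrightarrow> p i = (0::nat))}"
    by (rule finite_set_of_finite_funs) auto
qed

lemma shapes_0: "shapes h 0 = {\<lambda>_. 0}"
proof -
  have "p = (\<lambda>_. 0)" if "p \<in> shapes h 0" for p
    using that by (intro ext) (metis (mono_tags, lifting) finite_lessThan lessThan_iff mem_Collect_eq
      not_le_imp_less shapes_def sum_eq_0_iff)
  then show ?thesis
    by (auto simp: shapes_def)
qed

lemma shapes_Suc_mono: "p \<in> shapes h n \<Longrightarrow> p \<in> shapes (Suc h) n"
  by (auto simp: shapes_def)

lemma
  assumes "p \<in> shapes h n"
  shows finite_diagram: "finite (diagram p)" and card_diagram: "card (diagram p) = n"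
proof -
  have eq: "diagram p = Sigma {..<h} (\<lambda>i. {..<p i})"
    using assms by (auto simp: diagram_def shapes_def) (metis leI not_less_zero)
  show "finite (diagram p)" "card (diagram p) = n"
    unfolding eq using assms by (auto simp: shapes_def)
qed

lemma num_fillings_0: "num_fillings (\<lambda>_. 0) = 1"
proof -
  have "fillings (diagram (\<lambda>_. 0)) = {\<lambda>_. 0}"
    by (auto simp: fillings_def diagram_def bij_betw_def)
  then show ?thesis
    by (simp add: num_fillings_def)
qed

lemma removable_subset: "p \<in> shapes h n \<Longrightarrow> removable p \<subseteq> {..<h}"
  by (auto simp: shapes_def removable_def) (metis leI not_less_zero)

lemma finite_removable: "p \<in> shapes h n \<Longrightarrow> finite (removable p)"
  by (rule finite_subset[OF removable_subset finite_lessThan])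

text \<open>Row \<open>i + 1\<close> can grow exactly when row \<open>i\<close> is strictly longer,
  that is, when row \<open>i\<close> can shrink. The additional row 0 is the surplus of one that
  drives the commutation relation.\<close>

lemma addable_removable: "addable p = insert 0 (Suc ` removable p)"
proof -
  have "i \<in> addable p \<longleftrightarrow> i \<in> insert 0 (Suc ` removable p)" for i
    by (cases i) (auto simp: addable_def removable_def)
  then show ?thesis by blast
qed

lemma finite_addable: "p \<in> shapes h n \<Longrightarrow> finite (addable p)"
  by (simp add: addable_removable finite_removable)

lemma card_addable: "p \<in> shapes h n \<Longrightarrow> card (addable p) = Suc (card (removable p))"
  by (simp add: addable_removable finite_removable card_image)

section \<open>Adding and deleting a box\<close>

lemma sum_fun_upd_nat:
  fixes p :: "nat \<Rightarrow> nat"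
  assumes "i < h"
  shows "(\<Sum>j<h. (p(i := x)) j) + p i = (\<Sum>j<h. p j) + x"
  using assms by (simp add: sum.remove[of "{..<h}" i])

lemma add_box_shapes:
  assumes "p \<in> shapes h n" "i \<in> addable p" "i < h"
  shows "add_box i p \<in> shapes h (Suc n)"
  using assms sum_fun_upd_nat[of i h p "p i + 1"]
  by (cases i) (auto simp: shapes_def addable_def add_box_def le_SucI)

lemma del_box_shapes:
  assumes "p \<in> shapes h n" "i \<in> removable p"
  shows "del_box i p \<in> shapes h (n - 1)" "0 < n" "0 < p i"
proof -
  have i: "i < h"
    using assms removable_subset by auto
  show pos: "0 < p i"
    using assms by (auto simp: removable_def)
  show "del_box i p \<in> shapes h (n - 1)" "0 < n"
    using assms pos sum_fun_upd_nat[OF i, of p "p i - 1"]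
      member_le_sum[of i "{..<h}" p] i
    by (auto simp: shapes_def removable_def del_box_def le_diff_conv le_SucI)
qed

lemma del_add_box: "del_box i (add_box i p) = p"
  by (simp add: del_box_def add_box_def)

lemma add_del_box: "0 < p i \<Longrightarrow> add_box i (del_box i p) = p"
  by (auto simp: del_box_def add_box_def)

lemma removable_add_box: "p \<in> shapes h n \<Longrightarrow> i \<in> removable (add_box i p)"
  by (auto simp: removable_def add_box_def shapes_def le_imp_less_Suc)

lemma addable_del_box:
  assumes "p \<in> shapes h n" "i \<in> removable p"
  shows "i \<in> addable (del_box i p)"
proof -
  have "p (Suc j) \<le> p j" for j
    using assms(1) by (simp add: shapes_def)
  moreover have "0 < p i"
    using assms by (simp add: del_box_shapes(3))
  ultimately show ?thesis
    by (cases i) (auto simp: addable_def del_box_def intro: Suc_le_lessD)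
qed

text \<open>The corners of a diagram are the last cells \<open>(i, p i - 1)\<close> of its removable
  rows, so this is \<open>card_fillings\<close> in terms of shapes.\<close>

lemma num_fillings_rec:
  assumes p: "p \<in> shapes h n" and "0 < n"
  shows "num_fillings p = (\<Sum>i\<in>removable p. num_fillings (del_box i p))"
proof -
  have mono: "p (Suc i) \<le> p i" for i
    using p by (simp add: shapes_def)
  have "diagram p \<noteq> {}"
    using card_diagram[OF p] \<open>0 < n\<close> by auto
  then have "num_fillings p = (\<Sum>c\<in>corners (diagram p). card (fillings (diagram p - {c})))"
    unfolding num_fillings_def using card_fillings[OF finite_diagram[OF p]] by blast
  also have "\<dots> = (\<Sum>i\<in>removable p. num_fillings (del_box i p))"
  proof (rule sum.reindex_bij_witness[of _ "\<lambda>i. (i, p i - 1)" fst])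
    fix c assume "c \<in> corners (diagram p)"
    then obtain i j where c: "c = (i, j)" "j < p i" "\<not> j < p (Suc i)" "\<not> Suc j < p i"
      by (auto simp: corners_def diagram_def)
    then show "(fst c, p (fst c) - 1) = c" "fst c \<in> removable p"
      by (auto simp: removable_def)
    have "diagram (del_box i p) = diagram p - {c}"
      using c by (auto simp: diagram_def del_box_def split: if_splits)
    then show "num_fillings (del_box (fst c) p) = card (fillings (diagram p - {c}))"
      by (simp add: num_fillings_def c)
  next
    fix i assume "i \<in> removable p"
    then show "(i, p i - 1) \<in> corners (diagram p)"
      by (auto simp: corners_def diagram_def removable_def)
  qed auto
  finally show ?thesis .
qed

text \<open>Both sides run over the covering pairs between two consecutive levels, grouped by the
  upper shape on the left and by the lower shape on the right.\<close>

lemma sum_removable_swap: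
  fixes u :: "(nat \<Rightarrow> nat) \<Rightarrow> (nat \<Rightarrow> nat) \<Rightarrow> 'a::comm_monoid_add"
  shows "(\<Sum>p\<in>shapes h (Suc n). \<Sum>i\<in>removable p. u p (del_box i p))
       = (\<Sum>q\<in>shapes h n. \<Sum>i\<in>addable q \<inter> {..<h}. u (add_box i q) q)"
proof -
  have "(\<Sum>p\<in>shapes h (Suc n). \<Sum>i\<in>removable p. u p (del_box i p))
      = (\<Sum>(p, i)\<in>Sigma (shapes h (Suc n)) removable. u p (del_box i p))"
    by (rule sum.Sigma) (auto simp: finite_shapes intro: finite_removable)
  also have "\<dots> = (\<Sum>(q, i)\<in>Sigma (shapes h n) (\<lambda>q. addable q \<inter> {..<h}). u (add_box i q) q)"
  proof (rule sum.reindex_bij_witness[of _ "\<lambda>(q, i). (add_box i q, i)" "\<lambda>(p, i). (del_box i p, i)"],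
      goal_cases)
    case (1 a)
    then show ?case using del_box_shapes(3) by (auto simp: add_del_box)
  next
    case (2 a)
    then obtain p i where "a = (p, i)" "p \<in> shapes h (Suc n)" "i \<in> removable p"
      by auto
    then show ?case
      using del_box_shapes(1)[of p h "Suc n" i] addable_del_box[of p h "Suc n" i]
        removable_subset[of p h "Suc n"] by auto
  next
    case (5 a)
    then show ?case using del_box_shapes(3) by (auto simp: add_del_box)
  qed (auto simp: del_add_box add_box_shapes removable_add_box)
  also have "\<dots> = (\<Sum>q\<in>shapes h n. \<Sum>i\<in>addable q \<inter> {..<h}. u (add_box i q) q)"
    by (rule sum.Sigma[symmetric]) (auto simp: finite_shapes)
  finally show ?thesis .
qed

text \<open>Adding and deleting boxes are adjoint operations: the recursion for
  \<open>num_fillings\<close> is traded for a sum of the weight over the covering shapes.\<close>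

lemma sum_num_fillings_Suc:
  fixes w :: "(nat \<Rightarrow> nat) \<Rightarrow> real"
  shows "(\<Sum>p\<in>shapes h (Suc n). real (num_fillings p) * w p)
       = (\<Sum>q\<in>shapes h n. real (num_fillings q) * (\<Sum>i\<in>addable q \<inter> {..<h}. w (add_box i q)))"
proof -
  have "(\<Sum>p\<in>shapes h (Suc n). real (num_fillings p) * w p)
      = (\<Sum>p\<in>shapes h (Suc n). \<Sum>i\<in>removable p. real (num_fillings (del_box i p)) * w p)"
    by (rule sum.cong) (auto simp: num_fillings_rec sum_distrib_right)
  also have "\<dots> = (\<Sum>q\<in>shapes h n. \<Sum>i\<in>addable q \<inter> {..<h}. real (num_fillings q) * w (add_box i q))"
    by (rule sum_removable_swap)
  finally show ?thesis
    by (simp add: sum_distrib_left)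
qed

text \<open>The commutation relation \<open>DU - UD = 1\<close> in Young's lattice, by induction on \<open>n\<close>: the pairs \<open>i \<noteq> j\<close>
  of an added and a deleted box commute, and there is one more addable than removable row.\<close>

lemma sum_num_fillings_add_box:
  assumes "p \<in> shapes h n"
  shows "(\<Sum>i\<in>addable p. num_fillings (add_box i p)) = Suc n * num_fillings p"
  using assms
proof (induction n arbitrary: p)
  case (0 p)
  then have p: "p = (\<lambda>_. 0)"
    by (simp add: shapes_0)
  have "add_box 0 (\<lambda>_. 0) \<in> shapes 1 1"
    by (auto simp: shapes_def add_box_def)
  then have "num_fillings (add_box 0 (\<lambda>_. 0)) = (\<Sum>i\<in>removable (add_box 0 (\<lambda>_. 0)). num_fillings (del_box i (add_box 0 (\<lambda>_. 0))))"
    by (rule num_fillings_rec) simp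
  also have "removable (add_box 0 (\<lambda>_. 0)) = {0}"
    by (auto simp: removable_def add_box_def)
  finally have "num_fillings (add_box 0 (\<lambda>_. 0)) = num_fillings (\<lambda>_. 0)"
    by (simp add: del_add_box)
  moreover have "addable p = {0}"
    by (auto simp: addable_def p)
  ultimately show ?case
    by (simp add: p)
next
  case (Suc n p)
  \<comment> \<open>A box added in row \<open>h\<close> leaves \<open>shapes h\<close>, so the
    upward moves are made in \<open>Suc h\<close> rows; the induction hypothesis only concerns the
    downward moves, which keep \<open>h\<close>.\<close>
  have p': "p \<in> shapes (Suc h) (Suc n)"
    using Suc.prems by (rule shapes_Suc_mono)
  have sub: "addable p \<subseteq> {..<Suc h}"
    using removable_subset[OF Suc.prems] by (auto simp: addable_removable)
  define X where "X = Sigma (addable p) (\<lambda>i. removable (add_box i p) - {i})"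
  define Y where "Y = Sigma (removable p) (\<lambda>j. addable (del_box j p) - {j})"
  have up: "add_box i p \<in> shapes (Suc h) (Suc (Suc n))" if "i \<in> addable p" for i
    using add_box_shapes[OF p' that] sub that by auto
  have down: "del_box j p \<in> shapes h n" if "j \<in> removable p" for j
    using del_box_shapes(1)[OF Suc.prems that] by simp
  \<comment> \<open>The two moves share a comparison of rows only if \<open>i = Suc j\<close>, and
    then both orders require \<open>p i + 1 < p j\<close>.\<close>
  have XY: "(i, j) \<in> X \<longleftrightarrow> (j, i) \<in> Y" for i j
  proof -
    have "p (Suc j) \<le> p j" "p i \<le> p (i - 1)"
      using p' by (cases i; simp add: shapes_def)+
    then show ?thesis
      by (cases "i = Suc j") (auto simp: X_def Y_def addable_def removable_def add_box_def del_box_def)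
  qed
  have comm: "del_box j (add_box i p) = add_box i (del_box j p)" if "(j, i) \<in> Y" for i j
    using that by (auto simp: Y_def add_box_def del_box_def)
  have "(\<Sum>i\<in>addable p. num_fillings (add_box i p))
      = (\<Sum>i\<in>addable p. \<Sum>j\<in>removable (add_box i p). num_fillings (del_box j (add_box i p)))"
    by (rule sum.cong) (auto simp: num_fillings_rec[OF up])
  also have "\<dots> = (\<Sum>i\<in>addable p. num_fillings p + (\<Sum>j\<in>removable (add_box i p) - {i}. num_fillings (del_box j (add_box i p))))"
  proof (rule sum.cong[OF refl])
    fix i assume i: "i \<in> addable p"
    show "(\<Sum>j\<in>removable (add_box i p). num_fillings (del_box j (add_box i p)))
        = num_fillings p + (\<Sum>j\<in>removable (add_box i p) - {i}. num_fillings (del_box j (add_box i p)))"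
      by (subst sum.remove[OF finite_removable[OF up[OF i]] removable_add_box[OF p']])
        (simp add: del_add_box)
  qed
  also have "\<dots> = card (addable p) * num_fillings p + (\<Sum>(i, j)\<in>X. num_fillings (del_box j (add_box i p)))"
    unfolding X_def
    by (subst sum.Sigma[symmetric])
      (use finite_addable[OF p'] finite_removable[OF up] in \<open>auto simp: sum.distrib\<close>)
  also have "(\<Sum>(i, j)\<in>X. num_fillings (del_box j (add_box i p))) = (\<Sum>(j, i)\<in>Y. num_fillings (add_box i (del_box j p)))"
    by (rule sum.reindex_bij_witness[of _ prod.swap prod.swap])
      (auto simp: XY comm)
  also have "card (addable p) * num_fillings p + \<dots> = num_fillings p + (card (removable p) * num_fillings p + (\<Sum>(j, i)\<in>Y. num_fillings (add_box i (del_box j p))))"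
    by (simp add: card_addable[OF Suc.prems])
  also have "card (removable p) * num_fillings p + (\<Sum>(j, i)\<in>Y. num_fillings (add_box i (del_box j p)))
      = (\<Sum>j\<in>removable p. num_fillings p + (\<Sum>i\<in>addable (del_box j p) - {j}. num_fillings (add_box i (del_box j p))))"
    unfolding Y_def
    by (subst sum.Sigma[symmetric])
      (use finite_removable[OF Suc.prems] finite_addable[OF down] in \<open>auto simp: sum.distrib\<close>)
  also have "\<dots> = (\<Sum>j\<in>removable p. \<Sum>i\<in>addable (del_box j p). num_fillings (add_box i (del_box j p)))"
  proof (rule sum.cong[OF refl])
    fix j assume j: "j \<in> removable p"
    show "num_fillings p + (\<Sum>i\<in>addable (del_box j p) - {j}. num_fillings (add_box i (del_box j p)))
        = (\<Sum>i\<in>addable (del_box j p). num_fillings (add_box i (del_box j p)))"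
      by (subst sum.remove[OF finite_addable[OF down[OF j]] addable_del_box[OF Suc.prems j]])
        (simp add: add_del_box del_box_shapes(3)[OF Suc.prems j])
  qed
  also have "\<dots> = (\<Sum>j\<in>removable p. Suc n * num_fillings (del_box j p))"
    by (rule sum.cong) (auto simp: Suc.IH[OF down])
  also have "\<dots> = Suc n * num_fillings p"
    by (simp add: num_fillings_rec[OF Suc.prems] sum_distrib_left)
  finally show ?case
    by simp
qed

section \<open>Lattice walks\<close>

fun walks :: "nat \<Rightarrow> int \<Rightarrow> real" where
  "walks 0 j = (if j = 0 then 1 else 0)"
| "walks (Suc n) j = walks n (j - 1) + walks n (j + 1)"

declare walks.simps(2) [simp del]

lemma walks_uminus: "walks n (- j) = walks n j"
proof (induction n arbitrary: j)
  case (Suc n)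
  show ?case
    using Suc[of "j + 1"] Suc[of "j - 1"] by (simp add: walks.simps(2))
qed simp

lemma walks_far: "j < - int n \<Longrightarrow> walks n j = 0"
  by (induction n arbitrary: j) (auto simp: walks.simps(2))

lemma walks_parity: "odd (int n + j) \<Longrightarrow> walks n j = 0"
  by (induction n arbitrary: j) (auto simp: walks.simps(2))

text \<open>The end point \<open>2 * i - n\<close> is reached by exactly \<open>i\<close> up-steps;
  the induction is Pascal's rule.\<close>

lemma walks_binomial: "walks n (2 * int i - int n) = real (n choose i)"
proof (induction n arbitrary: i)
  case 0
  then show ?case by (cases i) auto
next
  case (Suc n)
  show ?case
  proof (cases i)
    case 0
    then show ?thesis
      using Suc[of 0] by (simp add: walks.simps(2) walks_far)
  next
    case (Suc i')
    then show ?thesis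
      using Suc.IH[of i'] Suc.IH[of i] by (simp add: walks.simps(2) algebra_simps)
  qed
qed

text \<open>Rotation by 45 degrees turns the steps \<open>(\<plusminus>1, 0), (0, \<plusminus>1)\<close> into two independent \<open>\<plusminus>1\<close> steps.\<close>

definition plane_walks :: "nat \<Rightarrow> int \<Rightarrow> int \<Rightarrow> real" where
  "plane_walks n i j = walks n (i + j) * walks n (i - j)"

lemma plane_walks_Suc:
  "plane_walks (Suc n) i j = plane_walks n (i - 1) j + plane_walks n (i + 1) j
     + plane_walks n i (j - 1) + plane_walks n i (j + 1)"
  by (simp add: plane_walks_def walks.simps(2) algebra_simps)

lemma plane_walks_swap: "plane_walks n i j = plane_walks n j i"
  using walks_uminus[of n "i - j"] by (simp add: plane_walks_def add.commute)

text \<open>The number of walks from 0 to \<open>j\<close> with \<open>k\<close> steps in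
  \<open>{-1, 0, 1}\<close>: the binomial coefficient chooses the \<open>n\<close> steps that
  move.\<close>

definition lazy_walks :: "nat \<Rightarrow> int \<Rightarrow> real" where
  "lazy_walks k j = (\<Sum>n\<le>k. real (k choose n) * walks n j)"

lemma lazy_walks_0: "lazy_walks 0 j = (if j = 0 then 1 else 0)"
  by (simp add: lazy_walks_def)

lemma lazy_walks_Suc:
  "lazy_walks (Suc k) j = lazy_walks k (j - 1) + lazy_walks k j + lazy_walks k (j + 1)"
proof -
  have "lazy_walks (Suc k) j = walks 0 j + (\<Sum>n\<le>k. real (Suc k choose Suc n) * walks (Suc n) j)"
    unfolding lazy_walks_def by (subst sum.atMost_Suc_shift) simp
  also have "\<dots> = (\<Sum>n\<le>k. real (k choose n) * walks (Suc n) j)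
      + (walks 0 j + (\<Sum>n\<le>k. real (k choose Suc n) * walks (Suc n) j))"
    by (simp add: algebra_simps sum.distrib)
  also have "walks 0 j + (\<Sum>n\<le>k. real (k choose Suc n) * walks (Suc n) j)
      = (\<Sum>n\<le>Suc k. real (k choose n) * walks n j)"
    by (subst sum.atMost_Suc_shift) simp
  also have "\<dots> = lazy_walks k j"
    by (simp add: lazy_walks_def)
  finally show ?thesis
    by (simp add: lazy_walks_def walks.simps(2) algebra_simps sum.distrib)
qed

lemma lazy_walks_uminus: "lazy_walks k (- j) = lazy_walks k j"
  by (simp add: lazy_walks_def walks_uminus)

text \<open>For symmetric \<open>f\<close>, such as the number of walks from \<open>0\<close> to \<open>i\<close>, \<open>line_sum f a\<close> is the sum of \<open>f i\<close>
  over \<open>i > - a\<close> minus the sum over \<open>i < - a\<close>, i.e. the signed number of walks starting at \<open>a\<close>.\<close>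

definition line_sum :: "(int \<Rightarrow> real) \<Rightarrow> int \<Rightarrow> real" where
  "line_sum f a = (\<Sum>i\<in>{1 - a..a}. f i)"

definition box_sum :: "(int \<Rightarrow> int \<Rightarrow> real) \<Rightarrow> int \<Rightarrow> int \<Rightarrow> real" where
  "box_sum f a b = (\<Sum>i\<in>{1 - a..a}. \<Sum>j\<in>{1 - b..b}. f i j)"

section \<open>Step recursions for signed walk counts\<close>

lemma sum_int_shift: "(\<Sum>i\<in>{a..b}. f (i + c)) = (\<Sum>i\<in>{a + c..b + c :: int}. f i)"
  by (rule sum.reindex_bij_witness[of _ "\<lambda>i. i - c" "\<lambda>i. i + c"]) auto

text \<open>The shifted windows are \<open>{- a..a - 1}\<close> and \<open>{2 - a..a + 1}\<close>.
  Moving the two points \<open>- a\<close> and \<open>1 - a\<close> from the first to the second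
  yields the windows of \<open>a - 1\<close> and \<open>a + 1\<close>.\<close>

lemma line_sum_step:
  assumes "a \<ge> 1"
  shows "line_sum (\<lambda>i. f (i - 1) + f (i + 1)) a = line_sum f (a - 1) + line_sum f (a + 1)"
proof -
  have ins: "{- a..a + 1} = insert (- a) (insert (1 - a) {2 - a..a + 1})"
      "{- a..a - 1} = insert (- a) (insert (1 - a) {2 - a..a - 1})"
    using assms by auto
  have "line_sum (\<lambda>i. f (i - 1) + f (i + 1)) a = sum f {- a..a - 1} + sum f {2 - a..a + 1}"
    using sum_int_shift[of "\<lambda>i. f i" "-1" "1 - a" a] sum_int_shift[of "\<lambda>i. f i" "1" "1 - a" a]
    by (simp add: line_sum_def sum.distrib)
  also have "\<dots> = sum f {2 - a..a - 1} + sum f {- a..a + 1}"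
    unfolding ins by simp
  finally show ?thesis
    by (simp add: line_sum_def)
qed

lemma box_sum_line_sum: "box_sum f a b = line_sum (\<lambda>i. line_sum (f i) b) a"
  by (simp add: box_sum_def line_sum_def)

lemma line_sum_add: "line_sum (\<lambda>i. f i + g i) a = line_sum f a + line_sum g a"
  by (simp add: line_sum_def sum.distrib)

lemma box_sum_swap: "box_sum f a b = box_sum (\<lambda>i j. f j i) b a"
  unfolding box_sum_def by (rule sum.swap)

lemma box_sum_plane_walks_swap: "box_sum (plane_walks n) a b = box_sum (plane_walks n) b a"
  by (subst box_sum_swap) (simp add: plane_walks_swap[symmetric])

lemma line_sum_0: "line_sum f 0 = 0"
  by (simp add: line_sum_def)

lemma box_sum_0: "box_sum f 0 b = 0" "box_sum f a 0 = 0"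
  by (simp_all add: box_sum_def)

lemma line_sum_lazy_walks_Suc:
  assumes "a \<ge> 1"
  shows "line_sum (lazy_walks (Suc n)) a
    = line_sum (lazy_walks n) (a - 1) + line_sum (lazy_walks n) a + line_sum (lazy_walks n) (a + 1)"
proof -
  have "line_sum (lazy_walks (Suc n)) a
      = line_sum (\<lambda>j. (lazy_walks n (j - 1) + lazy_walks n (j + 1)) + lazy_walks n j) a"
    by (intro arg_cong2[where f = line_sum] ext refl) (simp add: lazy_walks_Suc)
  then show ?thesis
    by (simp only: line_sum_add[of "\<lambda>j. lazy_walks n (j - 1) + lazy_walks n (j + 1)"] line_sum_step[OF assms])
qed

text \<open>\<open>line_sum_step\<close> is applied in each coordinate, first to the inner window
  and then to the outer one.\<close>

lemma box_sum_plane_walks_Suc: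
  assumes "a \<ge> 1" "b \<ge> 1"
  shows "box_sum (plane_walks (Suc n)) a b
    = box_sum (plane_walks n) (a - 1) b + box_sum (plane_walks n) (a + 1) b
    + box_sum (plane_walks n) a (b - 1) + box_sum (plane_walks n) a (b + 1)"
proof -
  let ?h = "plane_walks n"
  have "line_sum (plane_walks (Suc n) i) b
      = (line_sum (?h (i - 1)) b + line_sum (?h (i + 1)) b)
      + (line_sum (?h i) (b - 1) + line_sum (?h i) (b + 1))" for i
  proof -
    have "line_sum (plane_walks (Suc n) i) b
        = line_sum (\<lambda>j. (?h (i - 1) j + ?h (i + 1) j) + (?h i (j - 1) + ?h i (j + 1))) b"
      by (intro arg_cong2[where f = line_sum] ext refl) (simp add: plane_walks_Suc)
    then show ?thesis
      by (simp only: line_sum_add[of "\<lambda>j. ?h (i - 1) j + ?h (i + 1) j"]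
          line_sum_add[of "?h (i - 1)"] line_sum_step[OF assms(2)])
  qed
  then show ?thesis
    by (simp only: box_sum_line_sum line_sum_step[OF assms(1), of "\<lambda>i. line_sum (?h i) b"]
        line_sum_add[of "\<lambda>i. line_sum (?h i) (b - 1)"]
        line_sum_add[of "\<lambda>i. line_sum (?h (i - 1)) b + line_sum (?h (i + 1)) b"])
qed

lemma line_sum_lazy_walks_init: "a \<ge> 1 \<Longrightarrow> line_sum (lazy_walks 0) a = 1"
  by (simp add: line_sum_def lazy_walks_0)

lemma box_sum_plane_walks_init:
  assumes "a \<ge> 1" "b \<ge> 1"
  shows "box_sum (plane_walks 0) a b = 1"
proof -
  have "plane_walks 0 i j = (if j = 0 then if i = 0 then 1 else 0 else 0)" for i j
    by (auto simp: plane_walks_def)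
  then show ?thesis
    using assms by (simp add: box_sum_def)
qed

section \<open>Tableaux with at most three or four rows\<close>

text \<open>The sum of \<open>num_fillings p * G n p\<close> over level \<open>m\<close> depends
  only on \<open>m + n\<close>: going down one level replaces \<open>G n\<close> by
  \<open>G (Suc n)\<close>, since by \<open>wall\<close> the forbidden rows may be included in the
  sum at no cost.\<close>

lemma sum_num_fillings_eq_harmonic:
  fixes G :: "nat \<Rightarrow> (nat \<Rightarrow> nat) \<Rightarrow> real"
  assumes init: "\<And>m p. p \<in> shapes h m \<Longrightarrow> G 0 p = 1"
    and step: "\<And>m n p. p \<in> shapes h m \<Longrightarrow> G (Suc n) p = (\<Sum>i<h. G n (add_box i p))"
    and wall: "\<And>m n p i. p \<in> shapes h m \<Longrightarrow> i < h \<Longrightarrow> i \<notin> addable p \<Longrightarrow> G n (add_box i p) = 0"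
  shows "(\<Sum>p\<in>shapes h k. real (num_fillings p)) = G k (\<lambda>_. 0)"
proof -
  have "(\<Sum>p\<in>shapes h m. real (num_fillings p) * G n p) = G (m + n) (\<lambda>_. 0)" for m n
  proof (induction m arbitrary: n)
    case 0
    then show ?case by (simp add: shapes_0 num_fillings_0)
  next
    case (Suc m)
    have "(\<Sum>p\<in>shapes h (Suc m). real (num_fillings p) * G n p)
        = (\<Sum>q\<in>shapes h m. real (num_fillings q) * (\<Sum>i\<in>addable q \<inter> {..<h}. G n (add_box i q)))"
      by (rule sum_num_fillings_Suc)
    also have "\<dots> = (\<Sum>q\<in>shapes h m. real (num_fillings q) * G (Suc n) q)"
    proof (rule sum.cong[OF refl])
      fix q assume q: "q \<in> shapes h m"
      have "(\<Sum>i\<in>addable q \<inter> {..<h}. G n (add_box i q)) = (\<Sum>i<h. G n (add_box i q))"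
        by (rule sum.mono_neutral_left) (use wall[OF q] in auto)
      then show "real (num_fillings q) * (\<Sum>i\<in>addable q \<inter> {..<h}. G n (add_box i q)) = real (num_fillings q) * G (Suc n) q"
        by (simp add: step[OF q])
    qed
    also have "\<dots> = G (Suc m + n) (\<lambda>_. 0)"
      by (simp add: Suc.IH)
    finally show ?case .
  qed
  \<comment> \<open>In the order of schematic variables this sets \<open>n = 0\<close> and
    \<open>m = k\<close>.\<close>
  from this[of 0 k] show ?thesis
    by (simp add: init cong: sum.cong)
qed

section \<open>Gaps between shifted parts and the walls of the Weyl chamber\<close>

definition gap :: "(nat \<Rightarrow> nat) \<Rightarrow> nat \<Rightarrow> nat \<Rightarrow> int" where
  "gap p i j = int (p i) - int (p j) + int j - int i"

lemma shapes_antimono: "p \<in> shapes h n \<Longrightarrow> i \<le> j \<Longrightarrow> p j \<le> p i"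
  by (auto simp: shapes_def intro: lift_Suc_antimono_le)

lemma gap_ge_1: "p \<in> shapes h n \<Longrightarrow> i < j \<Longrightarrow> gap p i j \<ge> 1"
  using shapes_antimono[of p h n i j] by (simp add: gap_def)

lemma gap_add_box:
  assumes "i \<noteq> j"
  shows "gap (add_box l p) i j = gap p i j + (if l = i then 1 else if l = j then - 1 else 0)"
  using assms by (auto simp: gap_def add_box_def)

text \<open>A forbidden row \<open>i\<close> is as long as the row \<open>l\<close> above it. One
  more box makes the shifted parts of the two rows equal, so they become interchangeable in every
  gap.\<close>

lemma gap_wall:
  assumes "p \<in> shapes h n" "i \<notin> addable p"
  obtains l where "i = Suc l" "gap (add_box i p) l i = 0"
    "\<And>j. gap (add_box i p) l j = gap (add_box i p) i j"
    "\<And>j. gap (add_box i p) j l = gap (add_box i p) j i"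
proof -
  from assms(2) obtain l where l: "i = Suc l" "p l \<le> p i"
    by (cases i) (auto simp: addable_def)
  then have "p l = p i"
    using shapes_antimono[OF assms(1), of l i] by simp
  then show ?thesis
    by (intro that[OF l(1)]) (auto simp: l(1) gap_def add_box_def)
qed

text \<open>Stembridge's Pfaffians: \<open>3\<close> (completed by a phantom particle, hence the single factors) and
  \<open>4\<close> non-colliding particles at the positions \<open>p i - i\<close>, with free end points.\<close>

definition pfaffian3 :: "nat \<Rightarrow> (nat \<Rightarrow> nat) \<Rightarrow> real" where
  "pfaffian3 n p = line_sum (lazy_walks n) (gap p 0 1) - line_sum (lazy_walks n) (gap p 0 2)
     + line_sum (lazy_walks n) (gap p 1 2)"

definition pfaffian4 :: "nat \<Rightarrow> (nat \<Rightarrow> nat) \<Rightarrow> real" where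
  "pfaffian4 n p = box_sum (plane_walks n) (gap p 0 1) (gap p 2 3)
     - box_sum (plane_walks n) (gap p 0 2) (gap p 1 3)
     + box_sum (plane_walks n) (gap p 0 3) (gap p 1 2)"

lemma sum_num_fillings_shapes_3: "(\<Sum>p\<in>shapes 3 k. real (num_fillings p)) = lazy_walks k 0 - lazy_walks k 2"
proof -
  have "(\<Sum>p\<in>shapes 3 k. real (num_fillings p)) = pfaffian3 k (\<lambda>_. 0)"
  proof (rule sum_num_fillings_eq_harmonic)
    fix m p assume p: "p \<in> shapes 3 m"
    show "pfaffian3 0 p = 1"
      by (simp add: pfaffian3_def gap_ge_1[OF p] line_sum_lazy_walks_init)
    \<comment> \<open>Each gap involves two of the three rows, so the possible boxes change it by 1,
      -1 and 0: the steps of a lazy walk.\<close>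
    show "pfaffian3 (Suc n) p = (\<Sum>i<3. pfaffian3 n (add_box i p))" for n
      by (simp add: pfaffian3_def gap_ge_1[OF p] line_sum_lazy_walks_Suc gap_add_box eval_nat_numeral algebra_simps)
    show "pfaffian3 n (add_box i p) = 0" if i: "i < 3" and "i \<notin> addable p" for n i
    proof -
      obtain l where l: "i = Suc l" "gap (add_box i p) l i = 0"
        "\<And>j. gap (add_box i p) l j = gap (add_box i p) i j"
        "\<And>j. gap (add_box i p) j l = gap (add_box i p) j i"
        using gap_wall[OF p \<open>i \<notin> addable p\<close>] by blast
      consider "i = 1" "l = 0" | "i = 2" "l = 1"
        using i l(1) by linarith
      then show ?thesis
        \<comment> \<open>One term has gap 0 and vanishes; the other two are equal with opposite
          signs.\<close>
        using l by cases (simp_all add: pfaffian3_def line_sum_0)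
    qed
  qed
  also have "\<dots> = lazy_walks k 0 - lazy_walks k 2"
  proof -
    have "{0..1::int} = {0, 1}" "{-1..2::int} = {-1, 0, 1, 2}"
      by auto
    then show ?thesis
      using lazy_walks_uminus[of k 1] by (simp add: pfaffian3_def gap_def line_sum_def)
  qed
  finally show ?thesis .
qed

lemma sum_num_fillings_shapes_4:
  "(\<Sum>p\<in>shapes 4 k. real (num_fillings p))
    = (if even k then (walks k 0 - walks k 2) * (walks k 0 - walks k 4) else (walks k 1 - walks k 3)\<^sup>2)"
proof -
  have "(\<Sum>p\<in>shapes 4 k. real (num_fillings p)) = pfaffian4 k (\<lambda>_. 0)"
  proof (rule sum_num_fillings_eq_harmonic)
    fix m p assume p: "p \<in> shapes 4 m"
    show "pfaffian4 0 p = 1"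
      by (simp add: pfaffian4_def gap_ge_1[OF p] box_sum_plane_walks_init)
    \<comment> \<open>The two gaps in each term use all four rows once, so a box changes exactly one
      of them by 1 or -1: the four steps of a plane walk.\<close>
    show "pfaffian4 (Suc n) p = (\<Sum>i<4. pfaffian4 n (add_box i p))" for n
      by (simp add: pfaffian4_def gap_ge_1[OF p] box_sum_plane_walks_Suc gap_add_box eval_nat_numeral algebra_simps)
    show "pfaffian4 n (add_box i p) = 0" if i: "i < 4" and "i \<notin> addable p" for n i
    proof -
      obtain l where l: "i = Suc l" "gap (add_box i p) l i = 0"
        "\<And>j. gap (add_box i p) l j = gap (add_box i p) i j"
        "\<And>j. gap (add_box i p) j l = gap (add_box i p) j i"
        using gap_wall[OF p \<open>i \<notin> addable p\<close>] by blast
      consider "i = 1" "l = 0" | "i = 2" "l = 1" | "i = 3" "l = 2"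
        using i l(1) by linarith
      then show ?thesis
        \<comment> \<open>Again one term vanishes and the other two cancel; for \<open>i = 1\<close>
          this needs the symmetry of \<open>box_sum\<close> in its two gaps.\<close>
        using l by cases (simp_all add: pfaffian4_def box_sum_0 box_sum_plane_walks_swap)
    qed
  qed
  also have "\<dots> = (if even k then (walks k 0 - walks k 2) * (walks k 0 - walks k 4) else (walks k 1 - walks k 3)\<^sup>2)"
  proof -
    \<comment> \<open>At the empty shape \<open>gap\<close> is \<open>j - i\<close>, so the windows
      have half-widths 1, 2 and 3; parity then removes many of the products.\<close>
    have *: "{0..1::int} = {0, 1}" "{-1..2::int} = {-1, 0, 1, 2}" "{-2..3::int} = {-2, -1, 0, 1, 2, 3}"
      by auto
    have neg: "walks k (-1) = walks k 1" "walks k (-2) = walks k 2" "walks k (-3) = walks k 3" "walks k (-4) = walks k 4"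
      by (rule walks_uminus)+
    have "even k \<Longrightarrow> walks k 1 = 0 \<and> walks k 3 = 0"
         "odd k \<Longrightarrow> walks k 0 = 0 \<and> walks k 2 = 0 \<and> walks k 4 = 0"
      by (auto intro!: walks_parity)
    then show ?thesis
      by (auto simp: pfaffian4_def gap_def box_sum_def plane_walks_def * neg power2_eq_square algebra_simps)
  qed
  finally show ?thesis .
qed

section \<open>Catalan and Motzkin numbers\<close>

lemma binomial_succ: "real (Suc k) * real (n choose Suc k) = (real n - real k) * real (n choose k)"
proof (cases "k \<le> n")
  case True
  have "Suc k * (n choose Suc k) = (n - k) * (n choose k)"
    using binomial_absorption[of k n] binomial_absorb_comp[of n k] by simp
  then show ?thesis
    using True by (metis of_nat_diff of_nat_mult)
qed (simp add: binomial_eq_0)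

lemma catalan_Suc: "(real m + 2) * catalan (Suc m) = 2 * (2 * real m + 1) * catalan m"
proof -
  define b where "b = real (2 * m choose m)"
  have 1: "real (2 * m choose Suc m) = real m * b / (real m + 1)"
    using binomial_succ[of m "2 * m"] by (simp add: b_def field_simps)
  have "2 * Suc m choose Suc m = 2 * (Suc (2 * m) choose Suc m)"
    using binomial_symmetric[of m "Suc (2 * m)"] by simp
  also have "Suc (2 * m) choose Suc m = (2 * m choose m) + (2 * m choose Suc m)"
    by simp
  finally have "real (2 * Suc m choose Suc m) = 2 * (b + real m * b / (real m + 1))"
    by (simp only: of_nat_mult of_nat_add 1) (simp add: b_def)
  then have Suc_m: "catalan (Suc m) = 2 * (b + real m * b / (real m + 1)) / (real m + 2)"
    unfolding catalan_def by (simp only:) simp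
  have m: "catalan m = b / (real m + 1)"
    by (simp add: catalan_def b_def)
  show ?thesis
    unfolding Suc_m m by (simp add: divide_simps) (simp add: algebra_simps)
qed

lemma walks_even:
  "walks (2 * m) 0 = real (2 * m choose m)"
  "walks (2 * m) 2 = real (2 * m choose (m + 1))"
  "walks (2 * m) 4 = real (2 * m choose (m + 2))"
  using walks_binomial[of "2 * m" m] walks_binomial[of "2 * m" "m + 1"] walks_binomial[of "2 * m" "m + 2"]
  by simp_all

lemma walks_odd:
  "walks (2 * m + 1) 1 = real (2 * m + 1 choose (m + 1))"
  "walks (2 * m + 1) 3 = real (2 * m + 1 choose (m + 2))"
  using walks_binomial[of "2 * m + 1" "m + 1"] walks_binomial[of "2 * m + 1" "m + 2"]
  by simp_all

text \<open>Every binomial coefficient involved is a rational multiple of the central one,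
  \<open>b\<close>, which reduces the claims to identities of rational functions in
  \<open>m\<close>.\<close>

lemma walks_diff_catalan:
  "walks (2 * m) 0 - walks (2 * m) 2 = catalan m"
  "walks (2 * m) 0 - walks (2 * m) 4 = catalan (m + 1)"
  "walks (2 * m + 1) 1 - walks (2 * m + 1) 3 = catalan (m + 1)"
proof -
  define b where "b = real (2 * m choose m)"
  have c: "catalan m = b / (real m + 1)"
    by (simp add: catalan_def b_def)
  have c': "catalan (m + 1) = 2 * (2 * real m + 1) * b / ((real m + 1) * (real m + 2))"
    using catalan_Suc[of m] by (simp add: c divide_simps) (simp add: algebra_simps)
  have b1: "real (2 * m choose (m + 1)) = real m * b / (real m + 1)"
    using binomial_succ[of m "2 * m"] by (simp add: b_def field_simps)
  have b2: "real (2 * m choose (m + 2)) = real m * (real m - 1) * b / ((real m + 1) * (real m + 2))"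
  proof -
    have "(real m + 2) * real (2 * m choose (m + 2)) = (real m - 1) * real (2 * m choose (m + 1))"
      using binomial_succ[of "m + 1" "2 * m"] by (simp add: add.commute)
    then have "real (2 * m choose (m + 2)) = (real m - 1) * real (2 * m choose (m + 1)) / (real m + 2)"
      by (simp add: eq_divide_eq mult.commute)
    then show ?thesis
      unfolding b1 by simp
  qed
  show "walks (2 * m) 0 - walks (2 * m) 2 = catalan m"
    unfolding walks_even b1 c b_def[symmetric] by (simp add: field_simps)
  show "walks (2 * m) 0 - walks (2 * m) 4 = catalan (m + 1)"
    unfolding walks_even b2 c' b_def[symmetric]
    by (simp add: divide_simps) (simp add: algebra_simps)
  have "real (2 * m + 1 choose (m + 1)) = b + real m * b / (real m + 1)"
    "real (2 * m + 1 choose (m + 2)) = real m * b / (real m + 1)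
      + real m * (real m - 1) * b / ((real m + 1) * (real m + 2))"
    using b1 b2 b_def by simp_all
  then show "walks (2 * m + 1) 1 - walks (2 * m + 1) 3 = catalan (m + 1)"
    unfolding walks_odd c' by (simp only:) (simp add: divide_simps, simp add: algebra_simps)
qed

lemma lazy_walks_diff_motzkin: "lazy_walks k 0 - lazy_walks k 2 = motzkin k"
proof -
  let ?f = "\<lambda>n. real (k choose n) * (walks n 0 - walks n 2)"
  have "lazy_walks k 0 - lazy_walks k 2 = (\<Sum>n\<le>k. ?f n)"
    by (simp add: lazy_walks_def sum_subtractf algebra_simps)
  \<comment> \<open>The added terms have binomial coefficient 0; the longer range makes the even
    indices exactly the image of \<open>{..k}\<close> under doubling.\<close>
  also have "\<dots> = (\<Sum>n\<le>2 * k. ?f n)"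
    by (rule sum.mono_neutral_left) auto
  also have "\<dots> = (\<Sum>n\<in>(\<lambda>i. 2 * i) ` {..k}. ?f n)"
  proof (rule sum.mono_neutral_right)
    show "\<forall>n\<in>{..2 * k} - (\<lambda>i. 2 * i) ` {..k}. ?f n = 0"
    proof
      fix n assume "n \<in> {..2 * k} - (\<lambda>i. 2 * i) ` {..k}"
      then have "odd n" by (auto elim!: evenE)
      then show "?f n = 0" by (simp add: walks_parity)
    qed
  qed auto
  also have "\<dots> = (\<Sum>i\<le>k. ?f (2 * i))"
    by (subst sum.reindex) (auto simp: inj_on_def)
  also have "\<dots> = motzkin k"
    by (simp only: walks_diff_catalan(1)) (simp add: motzkin_def catalan_def)
  finally show ?thesis .
qed

lemma sum_num_fillings_shapes_4_catalan:
  "(\<Sum>p\<in>shapes 4 k. real (num_fillings p)) = catalan ((k + 1) div 2) * catalan ((k + 2) div 2)"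
proof (cases "even k")
  case True
  then obtain m where "k = 2 * m" by (elim evenE)
  then show ?thesis
    using walks_diff_catalan[of m] by (simp add: sum_num_fillings_shapes_4)
next
  case False
  then obtain m where "k = 2 * m + 1" by (elim oddE)
  then show ?thesis
    using walks_diff_catalan[of m] by (simp add: sum_num_fillings_shapes_4 power2_eq_square)
qed

section \<open>Exactly five rows with last row one\<close>

text \<open>Rows are numbered from 0, so \<open>p 4\<close> is the fifth part. The subtracted sum
  stands on the left, which keeps the identity in the naturals.\<close>

lemma sum_num_fillings_five_rows:
  "(\<Sum>p\<in>{p \<in> shapes 5 (Suc n). p 4 = 1}. num_fillings p) + (\<Sum>p\<in>shapes 4 (Suc (Suc n)). num_fillings p)
    = Suc n * (\<Sum>p\<in>shapes 4 n. num_fillings p) + (\<Sum>p\<in>shapes 3 (Suc n). num_fillings p)"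
proof -
  let ?five = "\<Sum>p\<in>{p \<in> shapes 5 (Suc n). p 4 = 1}. num_fillings p"
  let ?rem = "\<Sum>p\<in>shapes 4 (Suc n). card (removable p) * num_fillings p"
  have "Suc n * (\<Sum>p\<in>shapes 4 n. num_fillings p) = (\<Sum>p\<in>shapes 4 n. \<Sum>i\<in>addable p. num_fillings (add_box i p))"
    by (simp add: sum_num_fillings_add_box sum_distrib_left)
  also have "\<dots> = (\<Sum>p\<in>shapes 4 n. (\<Sum>i\<in>addable p \<inter> {..<4}. num_fillings (add_box i p))
      + (if 4 \<in> addable p then num_fillings (add_box 4 p) else 0))"
  proof (rule sum.cong[OF refl])
    fix p assume p: "p \<in> shapes 4 n"
    have "addable p \<subseteq> {..<5}"
      using removable_subset[OF p] by (auto simp: addable_removable)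
    then have "addable p = (addable p \<inter> {..<4}) \<union> (addable p \<inter> {4})"
      by auto
    then have "(\<Sum>i\<in>addable p. num_fillings (add_box i p))
        = (\<Sum>i\<in>(addable p \<inter> {..<4}) \<union> (addable p \<inter> {4}). num_fillings (add_box i p))"
      by simp
    also have "\<dots> = (\<Sum>i\<in>addable p \<inter> {..<4}. num_fillings (add_box i p)) + (\<Sum>i\<in>addable p \<inter> {4}. num_fillings (add_box i p))"
      by (rule sum.union_disjoint) auto
    finally show "(\<Sum>i\<in>addable p. num_fillings (add_box i p)) = (\<Sum>i\<in>addable p \<inter> {..<4}. num_fillings (add_box i p))
      + (if 4 \<in> addable p then num_fillings (add_box 4 p) else 0)"
      by simp
  qed
  also have "\<dots> = (\<Sum>p\<in>shapes 4 n. \<Sum>i\<in>addable p \<inter> {..<4}. num_fillings (add_box i p))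
      + (\<Sum>p\<in>{p \<in> shapes 4 n. 4 \<in> addable p}. num_fillings (add_box 4 p))"
    by (simp add: sum.distrib sum.inter_filter finite_shapes)
  \<comment> \<open>The summand depends on the upper shape alone, so each upper shape is counted
    once per removable row.\<close>
  also have "(\<Sum>p\<in>shapes 4 n. \<Sum>i\<in>addable p \<inter> {..<4}. num_fillings (add_box i p)) = ?rem"
    using sum_removable_swap[where u = "\<lambda>p q. num_fillings p" and h = 4 and n = n] by simp
  also have "(\<Sum>p\<in>{p \<in> shapes 4 n. 4 \<in> addable p}. num_fillings (add_box 4 p)) = ?five"
  proof (rule sum.reindex_bij_witness[of _ "del_box 4" "add_box 4"])
    fix p assume "p \<in> {p \<in> shapes 4 n. 4 \<in> addable p}"
    then have p: "p \<in> shapes 5 n" "4 \<in> addable p" "p 4 = 0"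
      using shapes_Suc_mono[of p 4 n] by (auto simp: shapes_def)
    then show "add_box 4 p \<in> {p \<in> shapes 5 (Suc n). p 4 = 1}"
      using add_box_shapes[OF p(1,2)] by (auto simp: add_box_def)
  next
    fix p assume "p \<in> {p \<in> shapes 5 (Suc n). p 4 = 1}"
    then have p: "p \<in> shapes 5 (Suc n)" "p 4 = 1"
      by auto
    then have r: "4 \<in> removable p"
      by (auto simp: removable_def shapes_def)
    have "del_box 4 p \<in> shapes 5 n" "del_box 4 p 4 = 0"
      using del_box_shapes(1)[OF p(1) r] p(2) by (auto simp: del_box_def)
    then have "del_box 4 p \<in> shapes 4 n"
      by (auto simp: shapes_def eval_nat_numeral le_Suc_eq) (metis Suc_leI le_neq_implies_less)
    then show "del_box 4 p \<in> {p \<in> shapes 4 n. 4 \<in> addable p}"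
      using addable_del_box[OF p(1) r] by simp
    show "add_box 4 (del_box 4 p) = p"
      using p by (simp add: add_del_box)
  qed (simp_all add: del_add_box)
  finally have 1: "Suc n * (\<Sum>p\<in>shapes 4 n. num_fillings p) = ?rem + ?five" .
  have "(\<Sum>p\<in>shapes 4 (Suc (Suc n)). num_fillings p) = (\<Sum>q\<in>shapes 4 (Suc n). card (addable q \<inter> {..<4}) * num_fillings q)"
  proof -
    have "real (\<Sum>p\<in>shapes 4 (Suc (Suc n)). num_fillings p) = real (\<Sum>q\<in>shapes 4 (Suc n). card (addable q \<inter> {..<4}) * num_fillings q)"
      using sum_num_fillings_Suc[where h = 4 and n = "Suc n" and w = "\<lambda>_. 1"] by (simp add: mult.commute)
    then show ?thesis
      by (simp only: of_nat_eq_iff)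
  qed
  also have "\<dots> = (\<Sum>q\<in>shapes 4 (Suc n). card (removable q) * num_fillings q + (if q 3 = 0 then num_fillings q else 0))"
  proof (rule sum.cong[OF refl])
    fix q assume q: "q \<in> shapes 4 (Suc n)"
    \<comment> \<open>The cut at four rows discards row 4, which is addable exactly if row 3 is
      removable. The surplus of addable over removable rows thus survives only if
      \<open>q 3 = 0\<close>.\<close>
    have "addable q \<inter> {..<4} = insert 0 (Suc ` (removable q - {3}))"
      using removable_subset[OF q] by (auto simp: addable_removable)
    then have c: "card (addable q \<inter> {..<4}) = Suc (card (removable q - {3}))"
      using finite_removable[OF q] by (simp add: card_image)
    have "3 \<in> removable q \<longleftrightarrow> q 3 \<noteq> 0"
      using q by (auto simp: removable_def shapes_def)
    then have "card (addable q \<inter> {..<4}) = card (removable q) + (if q 3 = 0 then 1 else 0)"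
      using c finite_removable[OF q] card_Suc_Diff1[of "removable q" 3] by (auto simp del: card_Diff_insert)
    then show "card (addable q \<inter> {..<4}) * num_fillings q = card (removable q) * num_fillings q + (if q 3 = 0 then num_fillings q else 0)"
      by simp
  qed
  also have "\<dots> = ?rem + (\<Sum>q\<in>{q \<in> shapes 4 (Suc n). q 3 = 0}. num_fillings q)"
    by (simp add: sum.distrib sum.inter_filter finite_shapes)
  also have "{q \<in> shapes 4 (Suc n). q 3 = 0} = shapes 3 (Suc n)"
    by (auto simp: shapes_def eval_nat_numeral le_Suc_eq) (metis Suc_leI le_neq_implies_less)
  finally show ?thesis
    using 1 by simp
qed

section \<open>Return to partitions as lists\<close>

lemma num_syt_eq_num_fillings:
  assumes "is_partition k lam"
  shows "num_syt lam = num_fillings (\<lambda>i. if i < length lam then lam ! i else 0)"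
proof -
  let ?p = "\<lambda>i. if i < length lam then lam ! i else 0"
  have cells: "cells lam = diagram ?p"
    by (auto simp: cells_def diagram_def split: if_splits)
  have "cells lam = Sigma {..<length lam} (\<lambda>i. {..<lam ! i})"
    by (auto simp: cells_def)
  then have "card (cells lam) = sum_list lam"
    by (simp add: sum_list_sum_nth atLeast0LessThan)
  then show ?thesis
    by (simp add: num_syt_def num_fillings_def SYT_def fillings_def cells[symmetric])
qed

lemma sum_num_syt_eq_sum_num_fillings:
  "(\<Sum>lam \<in> {lam. is_partition k lam \<and> length lam = 5 \<and> lam ! 4 = 1}. num_syt lam)
    = (\<Sum>p\<in>{p \<in> shapes 5 k. p 4 = 1}. num_fillings p)"
proof (rule sum.reindex_bij_witness[of _ "\<lambda>p. map p [0..<5]" "\<lambda>lam i. if i < length lam then lam ! i else 0"])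
  fix lam assume "lam \<in> {lam. is_partition k lam \<and> length lam = 5 \<and> lam ! 4 = 1}"
  then have lam: "is_partition k lam" "length lam = 5" "lam ! 4 = 1"
    by auto
  let ?p = "\<lambda>i. if i < length lam then lam ! i else 0"
  show "map ?p [0..<5] = lam"
    using lam(2) by (intro nth_equalityI) auto
  have "lam ! Suc i \<le> lam ! i" if "Suc i < 5" for i
    using lam that by (auto simp: is_partition_def sorted_wrt_iff_nth_less)
  moreover have "(\<Sum>i<5. lam ! i) = k"
    using lam by (auto simp: is_partition_def sum_list_sum_nth atLeast0LessThan)
  ultimately show "?p \<in> {p \<in> shapes 5 k. p 4 = 1}"
    using lam by (auto simp: shapes_def)
  show "num_fillings ?p = num_syt lam"
    by (rule num_syt_eq_num_fillings[OF lam(1), symmetric])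
next
  fix p assume "p \<in> {p \<in> shapes 5 k. p 4 = 1}"
  then have p: "p \<in> shapes 5 k" "p 4 = 1"
    by auto
  show "(\<lambda>i. if i < length (map p [0..<5]) then map p [0..<5] ! i else 0) = p"
    using p(1) by (auto simp: shapes_def)
  have anti: "p j \<le> p i" if "i \<le> j" for i j
    using shapes_antimono[OF p(1) that] .
  \<comment> \<open>A last part equal to 1 forces all five parts to be positive, as
    \<open>is_partition\<close> demands.\<close>
  then have "0 < p i" if "i < 5" for i
    using anti[of i 4] that p(2) by simp
  then have "is_partition k (map p [0..<5])"
    using p(1) anti
    by (auto simp: is_partition_def sorted_wrt_iff_nth_less shapes_def sum_list_sum_nth atLeast0LessThan)
  then show "map p [0..<5] \<in> {lam. is_partition k lam \<and> length lam = 5 \<and> lam ! 4 = 1}"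
    using p(2) by simp
qed

text \<open>Identifies the first term of the final formula with \<open>k\<close> times the number of
  tableaux with \<open>k - 1\<close> cells and at most four rows. One Catalan factor is common to
  both sides; \<open>catalan_Suc\<close> lowers the index of the other.\<close>

lemma catalan_product:
  assumes "k = Suc n"
  shows "real ((k + 1) div 2) * (real ((k + 2) div 2) + 1) / (real k + 1)
        * catalan ((k + 1) div 2) * catalan ((k + 2) div 2)
    = real k * (catalan ((n + 1) div 2) * catalan ((n + 2) div 2))"
proof (cases "even n")
  case True
  then obtain m where n: "n = 2 * m" by (elim evenE)
  then have k: "(k + 1) div 2 = m + 1" "(k + 2) div 2 = m + 1" "(n + 1) div 2 = m" "(n + 2) div 2 = m + 1"
    "real k = 2 * real m + 1"
    using assms by simp_all
  have "real (m + 1) * (real (m + 1) + 1) / (real k + 1) * catalan (m + 1) = (real m + 2) * catalan (Suc m) / 2"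
    by (simp add: k(5) divide_simps) (simp add: algebra_simps)
  also have "\<dots> = real k * catalan m"
    by (simp add: catalan_Suc k(5))
  finally show ?thesis
    unfolding k(1-4) by (simp add: mult.assoc)
next
  case False
  then obtain m where n: "n = 2 * m + 1" by (elim oddE)
  then have k: "(k + 1) div 2 = m + 1" "(k + 2) div 2 = Suc (m + 1)" "(n + 1) div 2 = m + 1" "(n + 2) div 2 = m + 1"
    "real k = 2 * real m + 2"
    using assms by simp_all
  have "real (m + 1) * (real (Suc (m + 1)) + 1) / (real k + 1) * catalan (Suc (m + 1))
      = (real m + 1) * ((real (m + 1) + 2) * catalan (Suc (m + 1))) / (2 * real m + 3)"
    by (simp add: k(5) algebra_simps)
  also have "\<dots> = real k * catalan (m + 1)"
    unfolding catalan_Suc by (simp add: k(5) divide_simps) (simp add: algebra_simps)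
  finally have "real (m + 1) * (real (Suc (m + 1)) + 1) / (real k + 1) * catalan (Suc (m + 1)) * catalan (m + 1)
      = real k * catalan (m + 1) * catalan (m + 1)"
    by (rule arg_cong)
  then show ?thesis
    unfolding k(1-4) by (simp only: mult_ac)
qed

theorem mainTheorem10:
  fixes k :: nat
  assumes "k \<ge> 3"
  shows "real (\<Sum>lam \<in> {lam. is_partition k lam \<and> length lam = 5 \<and> lam ! 4 = 1}. num_syt lam)
    = real ((k + 1) div 2) * (real ((k + 2) div 2) + 1) / (real k + 1)
        * catalan ((k + 1) div 2) * catalan ((k + 2) div 2)
      - catalan (k div 2 + 1) * catalan ((k + 1) div 2 + 1)
      + motzkin k"
proof -
  obtain n where k: "k = Suc n"
    using assms by (cases k) auto
  have "real (\<Sum>p\<in>{p \<in> shapes 5 k. p 4 = 1}. num_fillings p) + real (\<Sum>p\<in>shapes 4 (Suc k). num_fillings p)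
      = real k * real (\<Sum>p\<in>shapes 4 n. num_fillings p) + real (\<Sum>p\<in>shapes 3 k. num_fillings p)"
    using arg_cong[OF sum_num_fillings_five_rows[of n], of real] by (simp only: k of_nat_add of_nat_mult)
  moreover have "real (\<Sum>p\<in>shapes 4 (Suc k). num_fillings p) = catalan (k div 2 + 1) * catalan ((k + 1) div 2 + 1)"
    using sum_num_fillings_shapes_4_catalan[of "Suc k"] by simp
  moreover have "real (\<Sum>p\<in>shapes 3 k. num_fillings p) = motzkin k"
    using sum_num_fillings_shapes_3[of k] by (simp add: lazy_walks_diff_motzkin)
  moreover have "real k * real (\<Sum>p\<in>shapes 4 n. num_fillings p)
      = real ((k + 1) div 2) * (real ((k + 2) div 2) + 1) / (real k + 1)
        * catalan ((k + 1) div 2) * catalan ((k + 2) div 2)"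
    unfolding catalan_product[OF k] using sum_num_fillings_shapes_4_catalan[of n] by simp
  ultimately show ?thesis
    unfolding sum_num_syt_eq_sum_num_fillings by simp
qed

end
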